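(* Let $F:\mathbb R^n\to\mathbb R$ be twice continuously differentiable and consider the accelerated gradient method $$x_{k+1}=x_k-s\nabla F(x_k)+\beta_{\rm nag}(x_k-x_{k-1})-\big[\delta\nabla F(x_k)-\eta\nabla F(x_{k-1})\big].$$ Assume that $\beta_{\rm nag}=\beta_{\rm nag}(\sqrt{s})$, $\eta=\eta(\sqrt{s})$ and $\delta=\delta(\sqrt{s})$ are smooth functions of $\sqrt{s}$ satisfying $$\lim_{s\to0}\beta_{\rm nag}(\sqrt{s})=1,\quad \lim_{s\to0}\delta(\sqrt{s})=0,\quad \lim_{s\to0}\frac{\delta(\sqrt{s})-\eta(\sqrt{s})/\beta_{\rm nag}(\sqrt{s})}{\sqrt{s}\,\beta_{\rm nag}(\sqrt{s})}=0.$$ Suppose that, as $\tau\to0$, $\eta(\tau)=\beta_{\rm nag}(\tau)\big(\tau\eta_1+\tau^2\eta_2+o(\tau^2)\big)$ and $$\frac{\delta(\tau)+\tau^2-\eta(\tau)/\beta_{\rm nag}(\tau)}{\tau\beta_{\rm nag}(\tau)}=\tau\delta_1+\tau^2\delta_2+o(\tau^2)$$ with some $\eta_1,\eta_2,\delta_1,\delta_2\in\mathbb R$. Consider the equivalent template $X_{k+1}=\Phi_{\rm NAG}(X_k,\sqrt{s})$ with $X_k=(x_k,v_k)$, $v_k=\dfrac{x_k-x_{k-1}+(\eta/\beta_{\rm nag})\nabla F(x_{k-1})}{\sqrt{s}\,\beta_{\rm nag}}$ and, for $X=(x,v)\in\mathbb R^n\times\mathbb R^n$, $$\Phi_{\rm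 NAG}(X,\sqrt{s})=\begin{bmatrix}x+\sqrt{s}\,\beta_{\rm nag}^2v-(\delta+s)\nabla F(x)\\ \beta_{\rm nag}v-\frac{\delta+s-\eta/\beta_{\rm nag}}{\sqrt{s}\,\beta_{\rm nag}}\nabla F(x)\end{bmatrix}.$$ Then the $O(\sqrt{s})$-resolution ODE of the method with respect to this template is $$\begin{bmatrix} x \\ v \end{bmatrix}'=\begin{bmatrix}v-\eta_1\nabla F(x)\\ \beta_{\rm nag}'(0)v-\delta_1\nabla F(x)\end{bmatrix}+\frac{\sqrt{s}}{2}\left[\Gamma_{1,1}(x,v)-\Gamma_{1,2}(x,v)\right],$$ where $$\Gamma_{1,1}(x,v)=\begin{bmatrix}4\beta_{\rm nag}'(0)v-[2\eta_2+2\delta_1]\nabla F(x)\\ \beta_{\rm nag}''(0)v-2\delta_2\nabla F(x)\end{bmatrix},$$ $$\Gamma_{1,2}(x,v)=\begin{bmatrix}\eta_1^2\nabla^2F(x)\nabla F(x)-\eta_1\nabla^2F(x)v+\beta_{\rm nag}'(0)v-\delta_1\nabla F(x)\\ \eta_1\delta_1\nabla^2F(x)\nabla F(x)-\delta_1\nabla^2F(x)v+[\beta_{\rm nag}'(0)]^2v-\beta_{\rm nag}'(0)\delta_1\nabla F(x)\end{bmatrix}.$$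
   Context: $\beta_{\rm nag}',\beta_{\rm nag}''$ are derivatives with respect to $\tau=\sqrt{s}$; the value $\Phi_{\rm NAG}(X,0)$ is understood as the limit $s\to0^+$, which equals $X$ under the assumptions. Definition: given a template $X^+=\Phi(X,\sqrt{s})$ with $\Phi(X,0)=X$ for all $X$, an ODE $X'(t)=\Gamma_0(X(t))+\sqrt{s}\,\Gamma_1(X(t))$, $X(0)=X$, with $\Gamma_0,\Gamma_1$ independent of $s$, is the $O(\sqrt{s})$-resolution ODE with respect to the template if for every $X$ its solution satisfies $\|X(\sqrt{s})-X^+\|=o\big((\sqrt{s})^{2}\big)=o(s)$ as $s\to0^+$. *)

theory Defs
  imports "HOL-Analysis.Analysis" "HOL-Library.Landau_Symbols"
begin

definition grad :: "(real ^ 'n \<Rightarrow> real) \<Rightarrow> real ^ 'n \<Rightarrow> real ^ 'n" where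
  "grad F x = (THE D. GDERIV F x :> D)"

definition hessian :: "(real ^ 'n \<Rightarrow> real) \<Rightarrow> real ^ 'n \<Rightarrow> real ^ 'n ^ 'n" where
  "hessian F x = jacobian (grad F) (at x)"

definition twice_cont_differentiable :: "(real ^ 'n \<Rightarrow> real) \<Rightarrow> bool" where
  "twice_cont_differentiable F \<longleftrightarrow>
     (\<forall>x. F differentiable at x) \<and> (\<forall>x. grad F differentiable at x) \<and>
     continuous_on UNIV (hessian F)"

(* The coefficients of the method are functions of sqrt s >= 0, so derivatives are taken within
   {0..}: one-sided at 0, the ordinary derivative at t > 0. *)
definition rderiv :: "(real \<Rightarrow> real) \<Rightarrow> real \<Rightarrow> real" where
  "rderiv f t = vector_derivative f (at t within {0..})"

(* C-infinity on some half-open interval {0..<T}, with one-sided derivatives at 0. *)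
definition smooth_near_0 :: "(real \<Rightarrow> real) \<Rightarrow> bool" where
  "smooth_near_0 f \<longleftrightarrow>
     (\<exists>T>0. \<forall>k. \<forall>t\<in>{0..<T}. (rderiv ^^ k) f differentiable (at t within {0..}))"

definition ode_solution ::
  "('a::real_normed_vector \<Rightarrow> 'a) \<Rightarrow> ('a \<Rightarrow> 'a) \<Rightarrow> real \<Rightarrow> 'a \<Rightarrow> (real \<Rightarrow> 'a) \<Rightarrow> bool" where
  "ode_solution \<Gamma>0 \<Gamma>1 s X Y \<longleftrightarrow> Y 0 = X \<and>
     (\<forall>t\<in>{0..sqrt s}. (Y has_vector_derivative \<Gamma>0 (Y t) + sqrt s *\<^sub>R \<Gamma>1 (Y t))
                        (at t within {0..sqrt s}))"

(* The second argument of the template \<Phi> is sqrt s, and the condition \<Phi> X 0 = X is read as a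
   limit. Since \<Gamma>1 need only be continuous, solutions need not be unique: they are required to
   exist on {0..sqrt s} for all small s, and the error bound is required for every choice of them. *)
definition is_resolution_ode ::
  "('a::real_normed_vector \<Rightarrow> real \<Rightarrow> 'a) \<Rightarrow> ('a \<Rightarrow> 'a) \<Rightarrow> ('a \<Rightarrow> 'a) \<Rightarrow> bool" where
  "is_resolution_ode \<Phi> \<Gamma>0 \<Gamma>1 \<longleftrightarrow>
     (\<forall>X. ((\<lambda>s. \<Phi> X (sqrt s)) \<longlongrightarrow> X) (at_right 0)) \<and>
     (\<forall>X. (\<forall>\<^sub>F s in at_right 0. \<exists>Y. ode_solution \<Gamma>0 \<Gamma>1 s X Y) \<and>
       (\<forall>Y. (\<forall>\<^sub>F s in at_right 0. ode_solution \<Gamma>0 \<Gamma>1 s X (Y s)) \<longrightarrow>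
          (\<lambda>s. norm (Y s (sqrt s) - \<Phi> X (sqrt s))) \<in> o[at_right 0](\<lambda>s. s)))"

definition nag_method ::
  "(real ^ 'n \<Rightarrow> real) \<Rightarrow> (real \<Rightarrow> real) \<Rightarrow> (real \<Rightarrow> real) \<Rightarrow> (real \<Rightarrow> real) \<Rightarrow> real \<Rightarrow>
   (nat \<Rightarrow> real ^ 'n) \<Rightarrow> bool" where
  "nag_method F \<beta> \<delta> \<eta> s x \<longleftrightarrow>
     (\<forall>k\<ge>1. x (k + 1) = x k - s *\<^sub>R grad F (x k) + \<beta> (sqrt s) *\<^sub>R (x k - x (k - 1))
        - (\<delta> (sqrt s) *\<^sub>R grad F (x k) - \<eta> (sqrt s) *\<^sub>R grad F (x (k - 1))))"

definition nag_state ::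
  "(real ^ 'n \<Rightarrow> real) \<Rightarrow> (real \<Rightarrow> real) \<Rightarrow> (real \<Rightarrow> real) \<Rightarrow> real \<Rightarrow>
   (nat \<Rightarrow> real ^ 'n) \<Rightarrow> nat \<Rightarrow> (real ^ 'n) \<times> (real ^ 'n)" where
  "nag_state F \<beta> \<eta> s x k =
     (x k, (1 / (sqrt s * \<beta> (sqrt s))) *\<^sub>R
        (x k - x (k - 1) + (\<eta> (sqrt s) / \<beta> (sqrt s)) *\<^sub>R grad F (x (k - 1))))"

definition nag_template ::
  "(real ^ 'n \<Rightarrow> real) \<Rightarrow> (real \<Rightarrow> real) \<Rightarrow> (real \<Rightarrow> real) \<Rightarrow> (real \<Rightarrow> real) \<Rightarrow>
   (real ^ 'n) \<times> (real ^ 'n) \<Rightarrow> real \<Rightarrow> (real ^ 'n) \<times> (real ^ 'n)" where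
  "nag_template F \<beta> \<delta> \<eta> = (\<lambda>(x, v) \<tau>.
     (x + (\<tau> * (\<beta> \<tau>)\<^sup>2) *\<^sub>R v - (\<delta> \<tau> + \<tau>\<^sup>2) *\<^sub>R grad F x,
      \<beta> \<tau> *\<^sub>R v - ((\<delta> \<tau> + \<tau>\<^sup>2 - \<eta> \<tau> / \<beta> \<tau>) / (\<tau> * \<beta> \<tau>)) *\<^sub>R grad F x))"

(* In the fields below, b1 and b2 stand for the first and second derivatives of \<beta> at 0. *)

definition nag_\<Gamma>0 ::
  "(real ^ 'n \<Rightarrow> real) \<Rightarrow> real \<Rightarrow> real \<Rightarrow> real \<Rightarrow>
   (real ^ 'n) \<times> (real ^ 'n) \<Rightarrow> (real ^ 'n) \<times> (real ^ 'n)" where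
  "nag_\<Gamma>0 F b1 \<eta>1 \<delta>1 = (\<lambda>(x, v).
     (v - \<eta>1 *\<^sub>R grad F x, b1 *\<^sub>R v - \<delta>1 *\<^sub>R grad F x))"

definition nag_\<Gamma>11 ::
  "(real ^ 'n \<Rightarrow> real) \<Rightarrow> real \<Rightarrow> real \<Rightarrow> real \<Rightarrow> real \<Rightarrow> real \<Rightarrow>
   (real ^ 'n) \<times> (real ^ 'n) \<Rightarrow> (real ^ 'n) \<times> (real ^ 'n)" where
  "nag_\<Gamma>11 F b1 b2 \<eta>2 \<delta>1 \<delta>2 = (\<lambda>(x, v).
     ((4 * b1) *\<^sub>R v - (2 * \<eta>2 + 2 * \<delta>1) *\<^sub>R grad F x,
      b2 *\<^sub>R v - (2 * \<delta>2) *\<^sub>R grad F x))"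

definition nag_\<Gamma>12 ::
  "(real ^ 'n \<Rightarrow> real) \<Rightarrow> real \<Rightarrow> real \<Rightarrow> real \<Rightarrow>
   (real ^ 'n) \<times> (real ^ 'n) \<Rightarrow> (real ^ 'n) \<times> (real ^ 'n)" where
  "nag_\<Gamma>12 F b1 \<eta>1 \<delta>1 = (\<lambda>(x, v).
     (\<eta>1\<^sup>2 *\<^sub>R (hessian F x *v grad F x) - \<eta>1 *\<^sub>R (hessian F x *v v)
        + b1 *\<^sub>R v - \<delta>1 *\<^sub>R grad F x,
      (\<eta>1 * \<delta>1) *\<^sub>R (hessian F x *v grad F x) - \<delta>1 *\<^sub>R (hessian F x *v v)
        + b1\<^sup>2 *\<^sub>R v - (b1 * \<delta>1) *\<^sub>R grad F x))"

end

(* Let Y solve Y' = G0 Y + tau G1 Y, Y 0 = X, on {0..tau}. Such a Y stays within O(tau) of X, so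
   a second-order expansion gives
     Y tau = X + tau G0 X + tau^2 (G1 X + 1/2 DG0(X) (G0 X)) + o(tau^2),
   where only differentiability of G0 at X and continuity of G1 at X are needed. Hence the
   resolution ODE is read off the second-order expansion of the template: Gamma_{1,1} / 2 is its
   tau^2-coefficient, and Gamma_{1,2} = D Gamma_0 (Gamma_0). As the Hessian is merely continuous,
   existence of solutions is Peano's theorem, proved by Tonelli's delay method and Arzela-Ascoli. *)

theory Submission
  imports Defs "HOL-Complex_Analysis.Great_Picard"
begin

section \<open>Peano's existence theorem\<close>

lemma norm_diff_le_of_vector_derivative_bound:
  fixes g :: "real \<Rightarrow> 'a::real_normed_vector"
  assumes "\<And>t. t \<in> {a..b} \<Longrightarrow> (g has_vector_derivative g' t) (at t within {a..b})"
    and "\<And>t. t \<in> {a..b} \<Longrightarrow> norm (g' t) \<le> B"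
    and "x \<in> {a..b}" "y \<in> {a..b}"
  shows "norm (g x - g y) \<le> B * \<bar>x - y\<bar>"
proof -
  have "onorm (\<lambda>h. h *\<^sub>R g' t) \<le> B" if "t \<in> {a..b}" for t
    using assms(2)[OF that] by (intro onorm_le) (simp add: mult.commute[of B] mult_left_mono)
  from differentiable_bound[OF convex_real_interval(5) assms(1)[unfolded has_vector_derivative_def] this assms(3,4)]
  show ?thesis by simp
qed

text \<open>Clamping the delayed time at 0 amounts to extending \<open>Y\<close> to negative times
  by its initial value, so the delayed curve only reads \<open>Y\<close> inside the
  interval.\<close>

lemma continuous_on_delay:
  fixes h :: real
  assumes "continuous_on UNIV f" "continuous_on {0..a} Y" "0 < h"
  shows "continuous_on {0..a} (\<lambda>u. f (Y (max 0 (u - h))))"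
proof -
  have "continuous_on {0..a} (\<lambda>u. max 0 (u - h))"
    by (intro continuous_on_max continuous_intros)
  moreover have "(\<lambda>u. max 0 (u - h)) ` {0..a} \<subseteq> {0..a}"
    using assms(3) by (auto simp: max_def)
  ultimately show ?thesis
    by (intro continuous_on_compose2[OF assms(1)] continuous_on_compose2[OF assms(2)]) auto
qed

text \<open>With a positive delay, the \<open>k\<close>-th Picard iterate is already stationary on \<open>[0, kh]\<close>.\<close>

lemma delayed_integral_equation:
  fixes f :: "'a::banach \<Rightarrow> 'a" and a h :: real
  assumes f: "continuous_on UNIV f" and h: "0 < h"
  obtains Y where "continuous_on {0..a} Y"
    and "\<And>t. t \<in> {0..a} \<Longrightarrow> Y t = X + integral {0..t} (\<lambda>u. f (Y (max 0 (u - h))))"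
proof -
  define Z where "Z = rec_nat (\<lambda>_. X) (\<lambda>_ y t. X + integral {0..t} (\<lambda>u. f (y (max 0 (u - h)))))"
  have Z0: "Z 0 t = X" and ZSuc: "Z (Suc k) t = X + integral {0..t} (\<lambda>u. f (Z k (max 0 (u - h))))" for k t
    by (simp_all add: Z_def)
  have cont: "continuous_on {0..a} (Z k)" for k
  proof (induction k)
    case 0
    show ?case by (simp add: Z0[abs_def])
  next
    case (Suc k)
    have "continuous_on {0..a} (\<lambda>u. f (Z k (max 0 (u - h))))"
      by (rule continuous_on_delay[OF f Suc h])
    then show ?case
      unfolding ZSuc[abs_def]
      by (intro continuous_intros indefinite_integral_continuous_1 integrable_continuous_real)
  qed
  have agree: "Z (Suc k) t = Z k t" if "0 \<le> t" "t \<le> real k * h" for k t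
    using that
  proof (induction k arbitrary: t)
    case 0
    then show ?case by (simp add: Z0 ZSuc)
  next
    case (Suc k)
    \<comment> \<open>Up to time \<open>(k + 1) * h\<close> the integral reads the iterates only up
      to time \<open>k * h\<close>, where the induction hypothesis already identifies them.\<close>
    have "Z (Suc k) (max 0 (u - h)) = Z k (max 0 (u - h))" if "u \<in> {0..t}" for u
      using that Suc.prems h by (intro Suc.IH) (auto simp: algebra_simps)
    then show ?case
      unfolding ZSuc[of "Suc k"] ZSuc[of k t] by (intro arg_cong2[of _ _ _ _ "(+)"] integral_cong) auto
  qed
  obtain n where "a / h \<le> real n"
    using real_arch_simple by blast
  then have n: "a \<le> real n * h"
    using h by (simp add: field_simps)
  show thesis
  proof (rule that[OF cont[of n]])
    fix t assume "t \<in> {0..a}"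
    then show "Z n t = X + integral {0..t} (\<lambda>u. f (Z n (max 0 (u - h))))"
      using agree[of t n] n ZSuc[of n t] by auto
  qed
qed

text \<open>A global bound on \<open>f\<close> gives all delayed solutions the Lipschitz constant
  \<open>M\<close>. This yields a uniformly convergent subsequence, and it also bounds the effect of
  the delay by \<open>M\<close> times its length, so the limit satisfies the equation without
  delay.\<close>

theorem Peano_bounded:
  fixes f :: "'a::euclidean_space \<Rightarrow> 'a" and a :: real
  assumes f: "continuous_on UNIV f" and M: "\<And>x. norm (f x) \<le> M"
  obtains Y where "Y 0 = X"
    and "\<And>t. t \<in> {0..a} \<Longrightarrow> (Y has_vector_derivative f (Y t)) (at t within {0..a})"
proof (cases "0 \<le> a")
  case False
  then show thesis using that[of "\<lambda>_. X"] by auto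
next
  case True
  define h where "h n = inverse (real (Suc n))" for n
  have h: "0 < h n" for n by (simp add: h_def)
  have "\<exists>Y. continuous_on {0..a} Y \<and>
      (\<forall>t\<in>{0..a}. Y t = X + integral {0..t} (\<lambda>u. f (Y (max 0 (u - h n)))))" for n
    using delayed_integral_equation[OF f h] by metis
  then obtain Y where Y: "\<And>n. continuous_on {0..a} (Y n)"
    and Yeq: "\<And>n t. t \<in> {0..a} \<Longrightarrow> Y n t = X + integral {0..t} (\<lambda>u. f (Y n (max 0 (u - h n))))"
    by metis
  have cont: "continuous_on {0..a} (\<lambda>u. f (Y n (max 0 (u - h n))))" for n
    by (rule continuous_on_delay[OF f Y h])
  have "((\<lambda>t. X + integral {0..t} (\<lambda>u. f (Y n (max 0 (u - h n))))) has_vector_derivative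
      f (Y n (max 0 (t - h n)))) (at t within {0..a})" if "t \<in> {0..a}" for n t
    using integral_has_vector_derivative[OF cont that]
    by (simp add: has_vector_derivative_def has_derivative_add_const[of _ _ _ X, unfolded add.commute[of _ X]])
  then have "(Y n has_vector_derivative f (Y n (max 0 (t - h n)))) (at t within {0..a})"
    if "t \<in> {0..a}" for n t
    using that Yeq by (metis (no_types, lifting) has_vector_derivative_transform)
  note dY = this
  have Lip: "norm (Y n t - Y n u) \<le> M * \<bar>t - u\<bar>" if "t \<in> {0..a}" "u \<in> {0..a}" for n t u
    by (rule norm_diff_le_of_vector_derivative_bound[OF dY M that])
  have M0: "0 \<le> M" using M[of 0] norm_ge_zero order_trans by blast
  have Y0: "Y n 0 = X" for n using Yeq[of 0 n] True by simp
  obtain g k where g: "continuous_on {0..a} g" and k: "strict_mono (k :: nat \<Rightarrow> nat)"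
    and lim: "\<And>e. 0 < e \<Longrightarrow> \<exists>N. \<forall>n x. n \<ge> N \<and> x \<in> {0..a} \<longrightarrow> norm (Y (k n) x - g x) < e"
  proof (rule Arzela_Ascoli[of "{0..a}" Y "norm X + M * a"])
    show "norm (Y n t) \<le> norm X + M * a" if "t \<in> {0..a}" for n t
    proof -
      have "norm (Y n t - X) \<le> M * t"
        using Lip[of t 0 n] that True Y0 by simp
      also have "\<dots> \<le> M * a"
        using that M0 by (simp add: mult_left_mono)
      finally have "norm (Y n t - X) \<le> M * a" .
      then show ?thesis using norm_triangle_sub[of "Y n t" X] by linarith
    qed
    show "\<exists>d>0. \<forall>n y. y \<in> {0..a} \<and> norm (t - y) < d \<longrightarrow> norm (Y n t - Y n y) < e"
      if "t \<in> {0..a}" "0 < e" for t e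
    \<comment> \<open>The added 1 avoids a division by zero when \<open>M = 0\<close>.\<close>
    proof (intro exI[of _ "e / (M + 1)"] conjI allI impI)
      fix n y assume y: "y \<in> {0..a} \<and> norm (t - y) < e / (M + 1)"
      have "norm (Y n t - Y n y) \<le> M * \<bar>t - y\<bar>" using Lip that y by blast
      also have "\<dots> \<le> (M + 1) * \<bar>t - y\<bar>" by (simp add: mult_right_mono)
      also have "\<dots> < e" using y M0 by (simp add: field_simps)
      finally show "norm (Y n t - Y n y) < e" .
    qed (use that M0 in auto)
  qed auto
  have Yg: "(\<lambda>n. Y (k n) t) \<longlonglongrightarrow> g t" if "t \<in> {0..a}" for t
    unfolding LIMSEQ_iff using lim that by blast
  have hk: "(\<lambda>n. h (k n)) \<longlonglongrightarrow> 0"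
    using LIMSEQ_subseq_LIMSEQ[OF LIMSEQ_inverse_real_of_nat k] by (simp add: h_def o_def)
  \<comment> \<open>The clamped time differs from \<open>u\<close> by at most the delay, also when
    \<open>u\<close> is smaller than the delay; the common Lipschitz constant then makes the shift
    disappear in the limit.\<close>
  have delay: "(\<lambda>n. Y (k n) (max 0 (u - h (k n)))) \<longlonglongrightarrow> g u" if u: "u \<in> {0..a}" for u
  proof -
    have "norm (Y (k n) (max 0 (u - h (k n))) - Y (k n) u) \<le> M * h (k n)" for n
    proof -
      have m: "max 0 (u - h (k n)) \<in> {0..a}" "\<bar>max 0 (u - h (k n)) - u\<bar> \<le> h (k n)"
        using u h[of "k n"] by (auto simp: max_def)
      show ?thesis
        by (rule order_trans[OF Lip[OF m(1) u] mult_left_mono[OF m(2) M0]])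
    qed
    then have "(\<lambda>n. Y (k n) (max 0 (u - h (k n))) - Y (k n) u) \<longlonglongrightarrow> 0"
      by (rule Lim_null_comparison[OF always_eventually[OF allI] tendsto_mult_right_zero[OF hk]])
    from tendsto_add[OF this Yg[OF u]] show ?thesis by simp
  qed
  have geq: "g t = X + integral {0..t} (\<lambda>u. f (g u))" if t: "t \<in> {0..a}" for t
  proof -
    have "(\<lambda>n. integral {0..t} (\<lambda>u. f (Y (k n) (max 0 (u - h (k n)))))) \<longlonglongrightarrow> integral {0..t} (\<lambda>u. f (g u))"
    proof (rule dominated_convergence(2)[where h = "\<lambda>_. M"])
      show "(\<lambda>u. f (Y (k n) (max 0 (u - h (k n))))) integrable_on {0..t}" for n
        using t by (intro integrable_continuous_real continuous_on_subset[OF cont]) auto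
      show "(\<lambda>n. f (Y (k n) (max 0 (u - h (k n))))) \<longlonglongrightarrow> f (g u)" if "u \<in> {0..t}" for u
        using f delay[of u] that t by (intro isCont_tendsto_compose[of _ f]) (auto simp: continuous_on_eq_continuous_at)
    qed (use M in auto)
    then have "(\<lambda>n. Y (k n) t) \<longlonglongrightarrow> X + integral {0..t} (\<lambda>u. f (g u))"
      unfolding Yeq[OF t] by (intro tendsto_intros)
    with Yg[OF t] show ?thesis using LIMSEQ_unique by blast
  qed
  have contfg: "continuous_on {0..a} (\<lambda>u. f (g u))"
    by (intro continuous_on_compose2[OF f] g) auto
  show thesis
  proof
    show "g 0 = X" using geq[of 0] True by simp
    fix t assume t: "t \<in> {0..a}"
    have "((\<lambda>t. X + integral {0..t} (\<lambda>u. f (g u))) has_vector_derivative f (g t)) (at t within {0..a})"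
      using integral_has_vector_derivative[OF contfg t]
      by (simp add: has_vector_derivative_def has_derivative_add_const[of _ _ _ X, unfolded add.commute[of _ X]])
    then show "(g has_vector_derivative f (g t)) (at t within {0..a})"
      using t geq by (metis (no_types, lifting) has_vector_derivative_transform)
  qed
qed

section \<open>Confinement of solutions to a ball, and local existence\<close>

text \<open>A first-exit argument: until the curve first reaches distance \<open>r\<close> from
  \<open>X\<close> its speed is at most \<open>M\<close>, so it has moved at most
  \<open>M * \<tau>\<close>, which is less than \<open>r\<close>. A bound on \<open>f\<close> near
  \<open>X\<close> therefore controls every solution.\<close>

lemma solution_stays_close:
  fixes Y :: "real \<Rightarrow> 'a::real_normed_vector"
  assumes Y0: "Y 0 = X"
    and Y: "\<And>t. t \<in> {0..\<tau>} \<Longrightarrow> (Y has_vector_derivative f (Y t)) (at t within {0..\<tau>})"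
    and M: "\<And>Z. norm (Z - X) \<le> r \<Longrightarrow> norm (f Z) \<le> M"
    and small: "M * \<tau> < r" and r: "0 < r" and t: "t \<in> {0..\<tau>}"
  shows "norm (Y t - X) \<le> M * t" "norm (Y t - X) < r"
proof -
  have M0: "0 \<le> M" using order_trans[OF norm_ge_zero M[of X]] r by simp
  have cont: "continuous_on {0..\<tau>} Y"
    using Y by (intro continuous_on_vector_derivative)
  have *: "norm (Y t - X) < r" if t: "t \<in> {0..\<tau>}" for t
  proof (rule ccontr)
    define S where "S = {0..\<tau>} \<inter> (\<lambda>t. norm (Y t - X)) -` {r..}"
    assume "\<not> norm (Y t - X) < r"
    then have "S \<noteq> {}" using t by (auto simp: S_def)
    moreover have "compact S"
      unfolding S_def compact_eq_bounded_closed
      by (intro conjI continuous_closed_preimage continuous_intros cont bounded_Int) auto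
    ultimately obtain m where m: "m \<in> S" "\<And>u. u \<in> S \<Longrightarrow> m \<le> u"
      using compact_attains_inf by metis
    have mr: "r \<le> norm (Y m - X)" "m \<in> {0..\<tau>}" using m(1) by (auto simp: S_def)
    then have m0: "0 < m" using Y0 r by (cases "m = 0") auto
    have "norm (Y m - Y 0) \<le> M * m - M * 0"
    \<comment> \<open>Speed is bounded only at times strictly before \<open>m\<close>: minimality of
      \<open>m\<close> puts those points inside the ball, whereas at \<open>m\<close> itself only a
      lower bound on the distance is at hand.\<close>
    proof (rule differentiable_bound_general[OF m0, where f' = "\<lambda>t. f (Y t)" and \<phi>' = "\<lambda>_. M"])
      show "continuous_on {0..m} Y" using mr by (intro continuous_on_subset[OF cont]) auto
      fix u assume u: "0 < u" "u < m"
      then show "(Y has_vector_derivative f (Y u)) (at u)"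
        using Y[of u] mr by (simp add: at_within_Icc_at)
      have "u \<notin> S" using m(2)[of u] u by auto
      then show "norm (f (Y u)) \<le> M" using u mr by (intro M) (auto simp: S_def)
    qed (auto intro!: continuous_intros derivative_eq_intros)
    also have "\<dots> \<le> M * \<tau>" using mr M0 by (simp add: mult_left_mono)
    finally show False using mr small Y0 by simp
  qed
  show "norm (Y t - X) < r" using * t .
  have "norm (Y t - Y 0) \<le> M * \<bar>t - 0\<bar>"
    using Y M[OF less_imp_le[OF *]] t by (intro norm_diff_le_of_vector_derivative_bound[of 0 \<tau>]) auto
  then show "norm (Y t - X) \<le> M * t" using Y0 t by simp
qed

text \<open>Off the ball, \<open>f\<close> is replaced by its composition with the projection onto the ball; the solution
  never gets there.\<close>

lemma Peano_local:
  fixes f :: "'a::euclidean_space \<Rightarrow> 'a"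
  assumes f: "continuous_on UNIV f" and M: "\<And>Z. norm (Z - X) \<le> r \<Longrightarrow> norm (f Z) \<le> M"
    and small: "M * \<tau> < r" and r: "0 < r"
  shows "\<exists>Y. Y 0 = X \<and>
    (\<forall>t\<in>{0..\<tau>}. (Y has_vector_derivative f (Y t)) (at t within {0..\<tau>}))"
proof -
  define P where "P = closest_point (cball X r)"
  have P: "continuous_on UNIV P" "P Z \<in> cball X r" "Z \<in> cball X r \<Longrightarrow> P Z = Z" for Z
    using r unfolding P_def
    by (auto intro!: continuous_on_closest_point closest_point_self closest_point_in_set simp del: mem_cball)
  have PM: "norm (f (P Z)) \<le> M" for Z
    using P(2)[of Z] by (intro M) (auto simp: dist_norm norm_minus_commute)
  obtain Y where Y: "Y 0 = X"
    "\<And>t. t \<in> {0..\<tau>} \<Longrightarrow> (Y has_vector_derivative f (P (Y t))) (at t within {0..\<tau>})"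
    using Peano_bounded[of "\<lambda>Z. f (P Z)" M X \<tau>] PM continuous_on_compose2[OF f P(1)] by auto
  have "norm (Y t - X) < r" if "t \<in> {0..\<tau>}" for t
    using solution_stays_close(2)[of Y X \<tau> "\<lambda>Z. f (P Z)" r M t] Y PM small r that by blast
  then have "P (Y t) = Y t" if "t \<in> {0..\<tau>}" for t
    using that by (intro P(3)) (auto simp: dist_norm norm_minus_commute less_imp_le)
  with Y show ?thesis by metis
qed

text \<open>Expansions are made in \<open>\<tau> = sqrt s\<close>, while resolution ODEs are defined
  through \<open>s\<close>; this limit carries eventual statements from one to the other.\<close>

lemma filterlim_sqrt_at_right_0: "filterlim sqrt (at_right 0) (at_right 0)"
  by (auto simp: filterlim_at eventually_at_filter intro!: always_eventually tendsto_eq_intros)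

section \<open>Second-order expansion of solutions\<close>

text \<open>The mean value inequality is used twice: a first-order estimate of \<open>Y\<close> is
  fed into the linearization of \<open>G0\<close>, which then bounds the derivative of the
  second-order remainder. The threshold on \<open>\<tau>\<close> is fixed before \<open>Y\<close>,
  so it serves all solutions at once.\<close>

lemma local_solution_expansion:
  fixes G0 G1 :: "'a::real_normed_vector \<Rightarrow> 'a"
  assumes G0: "(G0 has_derivative L) (at X)" and G1: "isCont G1 X" and \<epsilon>: "0 < \<epsilon>"
  shows "\<forall>\<^sub>F \<tau> in at_right 0. \<forall>Y. Y 0 = X \<longrightarrow>
    (\<forall>t\<in>{0..\<tau>}. (Y has_vector_derivative G0 (Y t) + \<tau> *\<^sub>R G1 (Y t)) (at t within {0..\<tau>})) \<longrightarrow>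
    norm (Y \<tau> - (X + \<tau> *\<^sub>R G0 X + \<tau>\<^sup>2 *\<^sub>R (G1 X + (1 / 2) *\<^sub>R L (G0 X)))) \<le> \<epsilon> * \<tau>\<^sup>2"
proof -
  have L: "bounded_linear L" using G0 by (rule has_derivative_bounded_linear)
  then obtain K where K: "0 < K" "\<And>v. norm (L v) \<le> norm v * K"
    using bounded_linear.pos_bounded by blast
  \<comment> \<open>The 2 absorbs the variation of \<open>G0\<close> and \<open>G1\<close> near
    \<open>X\<close>, each below \<open>e\<close>, hence below 1.\<close>
  define M where "M = norm (G0 X) + norm (G1 X) + 2"
  have M: "0 < M" by (simp add: M_def add_nonneg_pos)
  \<comment> \<open>Chosen for the last estimate below, whose three errors contribute the factors
    \<open>M\<close>, \<open>2 * K\<close> and 1.\<close>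
  define e where "e = min 1 (\<epsilon> / (M + 2 * K + 1))"
  have e: "0 < e" "e \<le> 1" using \<epsilon> M K by (auto simp: e_def)
  have "e \<le> \<epsilon> / (M + 2 * K + 1)" by (simp add: e_def)
  then have e\<epsilon>: "e * (M + 2 * K + 1) \<le> \<epsilon>" using M K by (simp add: field_simps)
  have "isCont G0 X" using G0 has_derivative_continuous by blast
  then obtain d0 where d0: "0 < d0" "\<And>Z. norm (Z - X) < d0 \<Longrightarrow> norm (G0 Z - G0 X) < e"
    using e unfolding continuous_at_eps_delta dist_norm by metis
  obtain d1 where d1: "0 < d1" "\<And>Z. norm (Z - X) < d1 \<Longrightarrow> norm (G1 Z - G1 X) < e"
    using e G1 unfolding continuous_at_eps_delta dist_norm by metis
  obtain d2 where d2: "0 < d2"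
    "\<And>Z. norm (Z - X) < d2 \<Longrightarrow> norm (G0 Z - G0 X - L (Z - X)) \<le> e * norm (Z - X)"
    using e G0 unfolding has_derivative_at_alt by metis
  \<comment> \<open>Halving puts the closed ball of radius \<open>d\<close> inside all three open
    balls.\<close>
  define d where "d = min d0 (min d1 d2) / 2"
  have d: "0 < d" "d < d0" "d < d1" "d < d2" using d0 d1 d2 by (auto simp: d_def)
  have "\<forall>\<^sub>F \<tau> in at_right 0. 0 < \<tau> \<and> \<tau> < min 1 (min (d / M) (e / M))"
    using d e M by (intro eventually_at_rightI[of 0 "min 1 (min (d / M) (e / M))"]) auto
  then show ?thesis
  proof eventually_elim
    case (elim \<tau>)
    then have \<tau>: "0 < \<tau>" "\<tau> \<le> 1" "M * \<tau> < d" "M * \<tau> \<le> e"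
      using M by (auto simp: field_simps)
    show ?case
    proof (intro allI impI)
      fix Y
      assume Y0: "Y 0 = X" and "\<forall>t\<in>{0..\<tau>}. (Y has_vector_derivative G0 (Y t) + \<tau> *\<^sub>R G1 (Y t)) (at t within {0..\<tau>})"
      then have Y: "(Y has_vector_derivative G0 (Y t) + \<tau> *\<^sub>R G1 (Y t)) (at t within {0..\<tau>})" if "t \<in> {0..\<tau>}" for t
        using that by blast
      have G1b: "norm (\<tau> *\<^sub>R G1 Z) \<le> \<tau> * M" and Gb: "norm (G0 Z + \<tau> *\<^sub>R G1 Z) \<le> M" if "norm (Z - X) \<le> d" for Z
      proof -
        have "norm (G0 Z) \<le> norm (G0 X) + 1"
          using d0(2)[of Z] d e that norm_triangle_sub[of "G0 Z" "G0 X"] by linarith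
        moreover have 1: "norm (G1 Z) \<le> norm (G1 X) + 1"
          using d1(2)[of Z] d e that norm_triangle_sub[of "G1 Z" "G1 X"] by linarith
        moreover have "norm (\<tau> *\<^sub>R G1 Z) \<le> norm (G1 Z)"
          using \<tau> by (simp add: mult_left_le_one_le)
        ultimately show "norm (G0 Z + \<tau> *\<^sub>R G1 Z) \<le> M"
          unfolding M_def using norm_triangle_ineq[of "G0 Z" "\<tau> *\<^sub>R G1 Z"] by linarith
        have "norm (G1 Z) \<le> M" using 1 unfolding M_def using norm_ge_zero[of "G0 X"] by linarith
        then show "norm (\<tau> *\<^sub>R G1 Z) \<le> \<tau> * M" using \<tau> by simp
      qed
      have close: "norm (Y t - X) \<le> M * t" "norm (Y t - X) < d" if "t \<in> {0..\<tau>}" for t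
        by (rule solution_stays_close[of Y X \<tau> "\<lambda>Z. G0 Z + \<tau> *\<^sub>R G1 Z" d M];
            use Y0 Y Gb \<tau>(3) d(1) that in blast)+
      \<comment> \<open>Two errors of size \<open>e\<close> add up: the variation of
        \<open>G0\<close> along the curve, and the term \<open>\<tau> *\<^sub>R G1\<close>, which is
        small because \<open>M * \<tau> \<le> e\<close>.\<close>
      have first: "norm (Y t - X - t *\<^sub>R G0 X) \<le> 2 * e * \<tau>" if t: "t \<in> {0..\<tau>}" for t
      proof -
        have "norm ((Y t - t *\<^sub>R G0 X) - (Y 0 - 0 *\<^sub>R G0 X)) \<le> (2 * e) * \<bar>t - 0\<bar>"
        proof (rule norm_diff_le_of_vector_derivative_bound[of 0 \<tau>])
          fix u assume u: "u \<in> {0..\<tau>}"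
          show "((\<lambda>t. Y t - t *\<^sub>R G0 X) has_vector_derivative G0 (Y u) + \<tau> *\<^sub>R G1 (Y u) - G0 X) (at u within {0..\<tau>})"
            by (auto intro!: derivative_eq_intros Y u)
          have "norm (G0 (Y u) - G0 X) \<le> e" using d0(2)[of "Y u"] d close(2)[OF u] by linarith
          moreover have "norm (\<tau> *\<^sub>R G1 (Y u)) \<le> e"
            using G1b[of "Y u"] close(2)[OF u] \<tau>(4) by (simp add: mult.commute)
          ultimately have "norm ((G0 (Y u) - G0 X) + \<tau> *\<^sub>R G1 (Y u)) \<le> e + e"
            by (rule norm_triangle_mono)
          then show "norm (G0 (Y u) + \<tau> *\<^sub>R G1 (Y u) - G0 X) \<le> 2 * e"
            by (simp add: algebra_simps)
        qed (use t in auto)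
        also have "\<dots> \<le> 2 * e * \<tau>" using t e by (simp add: mult_left_mono)
        finally show ?thesis using Y0 by (simp add: algebra_simps)
      qed
      \<comment> \<open>In the ODE \<open>\<tau>\<close> is a fixed parameter, so the
        \<open>G1\<close> term grows like \<open>t * \<tau>\<close>; it becomes quadratic only at
        the final time \<open>t = \<tau>\<close>.\<close>
      define W where "W t = Y t - t *\<^sub>R G0 X - (t * \<tau>) *\<^sub>R G1 X - (t\<^sup>2 / 2) *\<^sub>R L (G0 X)" for t
      have "norm (W \<tau> - W 0) \<le> (\<epsilon> * \<tau>) * \<bar>\<tau> - 0\<bar>"
      proof (rule norm_diff_le_of_vector_derivative_bound[of 0 \<tau>])
        fix u assume u: "u \<in> {0..\<tau>}"
        let ?W = "G0 (Y u) + \<tau> *\<^sub>R G1 (Y u) - G0 X - \<tau> *\<^sub>R G1 X - u *\<^sub>R L (G0 X)"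
        show "(W has_vector_derivative ?W) (at u within {0..\<tau>})"
          unfolding W_def[abs_def] by (auto intro!: derivative_eq_intros Y u)
        \<comment> \<open>The three errors are the linearization error of \<open>G0\<close>, the
          image under \<open>L\<close> of the first-order error, and the variation of
          \<open>G1\<close>.\<close>
        let ?A = "G0 (Y u) - G0 X - L (Y u - X)" and ?B = "L (Y u - X - u *\<^sub>R G0 X)"
          and ?C = "\<tau> *\<^sub>R (G1 (Y u) - G1 X)"
        have W: "?W = ?A + ?B + ?C"
          using L by (simp add: linear_simps algebra_simps)
        have "norm ?W \<le> norm ?A + norm ?B + norm ?C"
          unfolding W by (intro norm_triangle_mono order_refl)
        also have "norm ?A \<le> e * (M * \<tau>)"
        proof -
          have "norm (Y u - X) \<le> M * \<tau>"
            using order_trans[OF close(1)[OF u], of "M * \<tau>"] u M by simp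
          then show ?thesis
            using order_trans[OF d2(2)[of "Y u"] mult_left_mono] close(2)[OF u] d e by simp
        qed
        also have "norm ?B \<le> (2 * e * \<tau>) * K"
          using order_trans[OF K(2) mult_right_mono[OF first[OF u]]] K(1) by simp
        also have "norm ?C \<le> \<tau> * e"
          using d1(2)[of "Y u"] close(2)[OF u] d \<tau> by (simp add: mult_left_mono)
        also have "e * (M * \<tau>) + (2 * e * \<tau>) * K + \<tau> * e = (e * (M + 2 * K + 1)) * \<tau>"
          by (simp add: algebra_simps)
        also have "\<dots> \<le> \<epsilon> * \<tau>" using e\<epsilon> \<tau> by (simp add: mult_right_mono)
        finally show "norm ?W \<le> \<epsilon> * \<tau>" by simp
      qed (use \<tau> in auto)
      moreover have "W \<tau> - W 0 = Y \<tau> - (X + \<tau> *\<^sub>R G0 X + \<tau>\<^sup>2 *\<^sub>R (G1 X + (1 / 2) *\<^sub>R L (G0 X)))"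
        by (simp add: W_def Y0 algebra_simps power2_eq_square)
      ultimately show "norm (Y \<tau> - (X + \<tau> *\<^sub>R G0 X + \<tau>\<^sup>2 *\<^sub>R (G1 X + (1 / 2) *\<^sub>R L (G0 X)))) \<le> \<epsilon> * \<tau>\<^sup>2"
        using \<tau> by (simp add: power2_eq_square mult.assoc)
    qed
  qed
qed

text \<open>Compactness of the unit ball bounds both fields there, and for
  \<open>\<tau> \<le> 1\<close> the same constant bounds their combination. A solution then exists
  as soon as \<open>\<tau>\<close> is below \<open>1 / M\<close>.\<close>

lemma local_solution_exists:
  fixes G0 G1 :: "'a::euclidean_space \<Rightarrow> 'a"
  assumes G0: "continuous_on UNIV G0" and G1: "continuous_on UNIV G1"
  shows "\<forall>\<^sub>F \<tau> in at_right 0. \<exists>Y. Y 0 = X \<and>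
    (\<forall>t\<in>{0..\<tau>}. (Y has_vector_derivative G0 (Y t) + \<tau> *\<^sub>R G1 (Y t)) (at t within {0..\<tau>}))"
proof -
  let ?N = "\<lambda>Z. norm (G0 Z) + norm (G1 Z)"
  have "continuous_on UNIV ?N" by (intro continuous_intros G0 G1)
  then have "continuous_on (cball X 1) ?N" using continuous_on_subset by blast
  then obtain x where x: "\<forall>Z\<in>cball X 1. ?N Z \<le> ?N x"
    using continuous_attains_sup[OF compact_cball, of X 1 ?N] by auto
  define M where "M = ?N x + 1"
  have M: "0 < M" by (simp add: M_def add_nonneg_pos)
  have GM: "?N Z \<le> M" if "norm (Z - X) \<le> 1" for Z
  proof -
    have "Z \<in> cball X 1" using that by (simp add: dist_norm norm_minus_commute)
    then have "?N Z \<le> ?N x" using x by blast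
    then show ?thesis unfolding M_def by linarith
  qed
  have "\<forall>\<^sub>F \<tau> in at_right 0. 0 < \<tau> \<and> \<tau> < min 1 (1 / M)"
    using M by (intro eventually_at_rightI[of 0 "min 1 (1 / M)"]) auto
  then show ?thesis
  proof eventually_elim
    case (elim \<tau>)
    then have \<tau>: "0 \<le> \<tau>" "\<tau> \<le> 1" "M * \<tau> < 1" using M by (auto simp: field_simps)
    have G: "norm (G0 Z + \<tau> *\<^sub>R G1 Z) \<le> M" if "norm (Z - X) \<le> 1" for Z
    proof -
      have "norm (\<tau> *\<^sub>R G1 Z) \<le> norm (G1 Z)" using \<tau> by (simp add: mult_left_le_one_le)
      then show ?thesis using GM[OF that] norm_triangle_ineq[of "G0 Z" "\<tau> *\<^sub>R G1 Z"] by linarith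
    qed
    have cont: "continuous_on UNIV (\<lambda>Z. G0 Z + \<tau> *\<^sub>R G1 Z)"
      by (intro continuous_intros G0 G1)
    show ?case
      by (rule Peano_local[OF cont G \<tau>(3) zero_less_one])
  qed
qed

section \<open>From the expansion of a template to its resolution ODE\<close>

text \<open>Solution and template share a quadratic polynomial up to a small-o error, hence agree to
  that order. What remains for a concrete template is an expansion in \<open>\<tau>\<close>, with no
  differential equation involved.\<close>

theorem is_resolution_ode_of_expansion:
  fixes G0 G1 :: "'a::euclidean_space \<Rightarrow> 'a"
  assumes G0: "\<And>X. (G0 has_derivative L X) (at X)" and G1: "continuous_on UNIV G1"
    and exp: "\<And>X. (\<lambda>\<tau>. norm (\<Phi> X \<tau> - (X + \<tau> *\<^sub>R G0 X + \<tau>\<^sup>2 *\<^sub>R (G1 X + (1 / 2) *\<^sub>R L X (G0 X)))))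
                   \<in> o[at_right 0](\<lambda>\<tau>. \<tau>\<^sup>2)"
  shows "is_resolution_ode \<Phi> G0 G1"
proof -
  define T where "T X \<tau> = X + \<tau> *\<^sub>R G0 X + \<tau>\<^sup>2 *\<^sub>R (G1 X + (1 / 2) *\<^sub>R L X (G0 X))" for X \<tau>
  note exp = exp[folded T_def]
  note sqrt_ev = filterlim_sqrt_at_right_0[THEN eventually_compose_filterlim[rotated]]
  show ?thesis
    unfolding is_resolution_ode_def
  proof (intro conjI allI impI)
    fix X
    have "((\<lambda>\<tau>. norm (\<Phi> X \<tau> - T X \<tau>)) \<longlongrightarrow> 0) (at_right 0)"
    proof (rule tendsto_sandwich[OF _ _ tendsto_const])
      show "\<forall>\<^sub>F \<tau> in at_right 0. norm (\<Phi> X \<tau> - T X \<tau>) \<le> \<tau>\<^sup>2"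
        using landau_o.smallD[OF exp[of X], of 1] by simp
    qed (auto intro!: tendsto_eq_intros)
    then have "((\<lambda>\<tau>. \<Phi> X \<tau> - T X \<tau>) \<longlongrightarrow> 0) (at_right 0)"
      by (rule tendsto_norm_zero_cancel)
    moreover have "(T X \<longlongrightarrow> X) (at_right 0)"
      unfolding T_def[abs_def] by (auto intro!: tendsto_eq_intros)
    ultimately have "((\<lambda>\<tau>. (\<Phi> X \<tau> - T X \<tau>) + T X \<tau>) \<longlongrightarrow> 0 + X) (at_right 0)"
      by (rule tendsto_add)
    then have "(\<Phi> X \<longlongrightarrow> X) (at_right 0)" by simp
    then show "((\<lambda>s. \<Phi> X (sqrt s)) \<longlongrightarrow> X) (at_right 0)"
      using filterlim_sqrt_at_right_0 by (rule filterlim_compose)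
    have "continuous_on UNIV G0"
      using G0 has_derivative_continuous_on has_derivative_at_withinI by blast
    from sqrt_ev[OF local_solution_exists[OF this G1, of X]]
    show "\<forall>\<^sub>F s in at_right 0. \<exists>Y. ode_solution G0 G1 s X Y"
      by (simp add: ode_solution_def)
    fix Y assume Y: "\<forall>\<^sub>F s in at_right 0. ode_solution G0 G1 s X (Y s)"
    show "(\<lambda>s. norm (Y s (sqrt s) - \<Phi> X (sqrt s))) \<in> o[at_right 0](\<lambda>s. s)"
    proof (rule landau_o.smallI)
      fix c :: real assume c: "0 < c"
      have "isCont G1 X" using G1 continuous_on_eq_continuous_at by blast
      \<comment> \<open>Half of the tolerance goes to the error of the solution, the other half to
        that of the template.\<close>
      note close = local_solution_expansion[OF G0 this, of "c / 2", folded T_def]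
      have "0 < c / 2" using c by simp
      from sqrt_ev[OF close[OF this]] sqrt_ev[OF landau_o.smallD[OF exp[of X] this]]
        Y eventually_at_right_less[of 0]
      show "\<forall>\<^sub>F s in at_right 0. norm (norm (Y s (sqrt s) - \<Phi> X (sqrt s))) \<le> c * norm s"
      proof eventually_elim
        case (elim s)
        then have "norm (Y s (sqrt s) - T X (sqrt s)) \<le> c / 2 * s"
          unfolding ode_solution_def by simp
        moreover have "norm (\<Phi> X (sqrt s) - T X (sqrt s)) \<le> c / 2 * s"
          using elim by simp
        ultimately have "norm (Y s (sqrt s) - \<Phi> X (sqrt s)) \<le> c / 2 * s + c / 2 * s"
          using norm_diff_triangle_le norm_minus_commute by metis
        then show ?case using elim by simp
      qed
    qed
  qed
qed

section \<open>The accelerated gradient method\<close>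

text \<open>One-sided Taylor expansion with Peano remainder: differentiability of the first
  derivative at 0 makes the derivative of the remainder at most \<open>c * t\<close> on
  \<open>{0..t}\<close>, and the mean value inequality supplies the second factor
  \<open>t\<close>.\<close>

lemma smooth_near_0_taylor2:
  assumes "smooth_near_0 f"
  shows "(\<lambda>t. f t - (f 0 + t * rderiv f 0 + t\<^sup>2 / 2 * rderiv (rderiv f) 0)) \<in> o[at_right 0](\<lambda>t. t\<^sup>2)"
proof -
  let ?f' = "rderiv f" and ?b = "rderiv (rderiv f) 0"
  obtain T where T: "0 < T" "\<And>k t. t \<in> {0..<T} \<Longrightarrow> (rderiv ^^ k) f differentiable (at t within {0..})"
    using assms unfolding smooth_near_0_def by blast
  have f': "(f has_vector_derivative ?f' t) (at t within {0..})" if "t \<in> {0..<T}" for t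
    using T(2)[OF that, of 0] unfolding rderiv_def vector_derivative_works[symmetric] by simp
  have "(?f' has_vector_derivative ?b) (at 0 within {0..})"
    using T(1) T(2)[of 0 1] unfolding rderiv_def[of "rderiv f"] vector_derivative_works[symmetric] by simp
  note f'' = this[unfolded has_vector_derivative_def has_derivative_within_alt, THEN conjunct2, rule_format]
  show ?thesis
  proof (rule landau_o.smallI)
    fix c :: real assume c: "0 < c"
    obtain d where d: "0 < d"
      "\<forall>t\<in>{0..}. norm (t - 0) < d \<longrightarrow> norm (?f' t - ?f' 0 - (t - 0) *\<^sub>R ?b) \<le> c * norm (t - 0)"
      using f''[OF c] by blast
    have "\<forall>\<^sub>F t in at_right 0. 0 < t \<and> t < min T d"
      using T d by (intro eventually_at_rightI[of 0 "min T d"]) auto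
    then show "\<forall>\<^sub>F t in at_right 0. norm (f t - (f 0 + t * ?f' 0 + t\<^sup>2 / 2 * ?b)) \<le> c * norm (t\<^sup>2)"
    proof eventually_elim
      case (elim t)
      let ?g = "\<lambda>u. f u - u * ?f' 0 - u\<^sup>2 / 2 * ?b"
      have "norm (?g t - ?g 0) \<le> (c * t) * \<bar>t - 0\<bar>"
      proof (rule norm_diff_le_of_vector_derivative_bound[of 0 t])
        fix u assume u: "u \<in> {0..t}"
        have "(f has_vector_derivative ?f' u) (at u within {0..t})"
          by (rule has_vector_derivative_within_subset[OF f']) (use u elim in auto)
        then have "(f has_real_derivative ?f' u) (at u within {0..t})"
          by (simp only: has_real_derivative_iff_has_vector_derivative)
        then have "(?g has_real_derivative ?f' u - 1 * ?f' 0 - (2 * u / 2) * ?b) (at u within {0..t})"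
          by (intro DERIV_diff DERIV_cmult_right DERIV_ident DERIV_cdivide) (auto intro!: derivative_eq_intros)
        then show "(?g has_vector_derivative ?f' u - ?f' 0 - u * ?b) (at u within {0..t})"
          by (simp add: has_real_derivative_iff_has_vector_derivative)
        have "norm (?f' u - ?f' 0 - u * ?b) \<le> c * u" using d(2)[rule_format, of u] u elim by simp
        also have "\<dots> \<le> c * t" using u c by simp
        finally show "norm (?f' u - ?f' 0 - u * ?b) \<le> c * t" .
      next
        show "t \<in> {0..t}" "0 \<in> {0..t}" using elim by simp_all
      qed
      moreover have "?g t - ?g 0 = f t - (f 0 + t * ?f' 0 + t\<^sup>2 / 2 * ?b)"
        by simp
      ultimately show ?case using elim by (simp only: power2_eq_square) simp
    qed
  qed
qed

section \<open>Derivative and regularity of the vector fields\<close>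

definition nag_D\<Gamma>0 ::
  "(real ^ 'n \<Rightarrow> real) \<Rightarrow> real \<Rightarrow> real \<Rightarrow> real \<Rightarrow>
   (real ^ 'n) \<times> (real ^ 'n) \<Rightarrow> (real ^ 'n) \<times> (real ^ 'n) \<Rightarrow> (real ^ 'n) \<times> (real ^ 'n)" where
  "nag_D\<Gamma>0 F b1 \<eta>1 \<delta>1 X h =
     (snd h - \<eta>1 *\<^sub>R (hessian F (fst X) *v fst h), b1 *\<^sub>R snd h - \<delta>1 *\<^sub>R (hessian F (fst X) *v fst h))"

lemma nag_\<Gamma>0_has_derivative:
  assumes "twice_cont_differentiable F"
  shows "(nag_\<Gamma>0 F b1 \<eta>1 \<delta>1 has_derivative nag_D\<Gamma>0 F b1 \<eta>1 \<delta>1 X) (at X)"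
proof -
  have "(grad F has_derivative (\<lambda>h. hessian F x *v h)) (at x)" for x
    using assms unfolding twice_cont_differentiable_def hessian_def by (simp add: jacobian_works)
  from has_derivative_compose[OF has_derivative_fst[OF has_derivative_ident] this]
  have "((\<lambda>X. grad F (fst X)) has_derivative (\<lambda>h. hessian F (fst X) *v fst h)) (at X)" .
  then show ?thesis
    unfolding nag_\<Gamma>0_def nag_D\<Gamma>0_def[abs_def] split_def
    by (auto intro!: derivative_eq_intros)
qed

text \<open>This explains the subtracted field: the flow of \<open>nag_\<Gamma>0\<close> alone
  already produces half of this expression at second order, and the correction has to remove
  it.\<close>

lemma nag_\<Gamma>12_eq: "nag_\<Gamma>12 F b1 \<eta>1 \<delta>1 X = nag_D\<Gamma>0 F b1 \<eta>1 \<delta>1 X (nag_\<Gamma>0 F b1 \<eta>1 \<delta>1 X)"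
  by (simp add: nag_\<Gamma>12_def nag_D\<Gamma>0_def nag_\<Gamma>0_def split_def matrix_vector_mult_diff_distrib
      matrix_vector_mult_scaleR algebra_simps power2_eq_square)

lemma continuous_on_matrix_vector_mult:
  fixes A :: "'a::topological_space \<Rightarrow> real ^ 'n ^ 'm"
  assumes "continuous_on S A" "continuous_on S v"
  shows "continuous_on S (\<lambda>x. A x *v v x)"
  unfolding matrix_vector_mult_def
  by (intro continuous_on_vec_lambda continuous_intros assms continuous_on_component)

text \<open>Here continuity of the Hessian enters, as Peano's theorem requires a continuous
  field.\<close>

lemma continuous_on_nag_\<Gamma>1:
  assumes F: "twice_cont_differentiable F"
  shows "continuous_on UNIV (\<lambda>X. (1 / 2) *\<^sub>R (nag_\<Gamma>11 F b1 b2 \<eta>2 \<delta>1 \<delta>2 X - nag_\<Gamma>12 F b1 \<eta>1 \<delta>1 X))"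
proof -
  have "continuous_on UNIV (grad F)"
    using F unfolding twice_cont_differentiable_def
    by (intro continuous_at_imp_continuous_on) (simp add: differentiable_imp_continuous_within)
  note g = continuous_on_compose2[OF this continuous_on_fst[OF continuous_on_id] subset_UNIV]
  have "continuous_on UNIV (hessian F)" using F unfolding twice_cont_differentiable_def by blast
  note H = continuous_on_compose2[OF this continuous_on_fst[OF continuous_on_id] subset_UNIV]
  show ?thesis
    unfolding nag_\<Gamma>11_def nag_\<Gamma>12_def split_def
    by (intro continuous_intros continuous_on_matrix_vector_mult g H)
qed

section \<open>Quadratic expansion of the template\<close>

text \<open>Each remainder is written as \<open>\<tau>\<^sup>2\<close> times a function tending to
  0. The deviation from the quadratic part is then exactly
  \<open>\<tau>\<^sup>2 *\<^sub>R ?res \<tau>\<close>, by algebra, and only the limit of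
  \<open>?res\<close> is left.\<close>

lemma nag_template_expansion:
  fixes F :: "real ^ 'n \<Rightarrow> real" and b1 b2 :: real
  assumes \<beta>: "(\<lambda>\<tau>. \<beta> \<tau> - (1 + \<tau> * b1 + \<tau>\<^sup>2 / 2 * b2)) \<in> o[at_right 0](\<lambda>\<tau>. \<tau>\<^sup>2)"
    and r: "r\<^sub>\<eta> \<in> o[at_right 0](\<lambda>\<tau>. \<tau>\<^sup>2)" "r\<^sub>\<delta> \<in> o[at_right 0](\<lambda>\<tau>. \<tau>\<^sup>2)"
    and \<eta>: "\<forall>\<^sub>F \<tau> in at_right 0. \<eta> \<tau> = \<beta> \<tau> * (\<tau> * \<eta>1 + \<tau>\<^sup>2 * \<eta>2 + r\<^sub>\<eta> \<tau>)"
    and \<delta>: "\<forall>\<^sub>F \<tau> in at_right 0. (\<delta> \<tau> + \<tau>\<^sup>2 - \<eta> \<tau> / \<beta> \<tau>) / (\<tau> * \<beta> \<tau>) = \<tau> * \<delta>1 + \<tau>\<^sup>2 * \<delta>2 + r\<^sub>\<delta> \<tau>"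
  shows "(\<lambda>\<tau>. norm (nag_template F \<beta> \<delta> \<eta> X \<tau>
      - (X + \<tau> *\<^sub>R nag_\<Gamma>0 F b1 \<eta>1 \<delta>1 X + (\<tau>\<^sup>2 / 2) *\<^sub>R nag_\<Gamma>11 F b1 b2 \<eta>2 \<delta>1 \<delta>2 X)))
    \<in> o[at_right 0](\<lambda>\<tau>. \<tau>\<^sup>2)"
proof -
  obtain x v where X: "X = (x, v)" by (cases X)
  define R where "R \<tau> = (\<beta> \<tau> - (1 + \<tau> * b1 + \<tau>\<^sup>2 / 2 * b2)) / \<tau>\<^sup>2" for \<tau>
  define E where "E \<tau> = r\<^sub>\<eta> \<tau> / \<tau>\<^sup>2" for \<tau>
  define D where "D \<tau> = r\<^sub>\<delta> \<tau> / \<tau>\<^sup>2" for \<tau>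
  have lim: "(R \<longlongrightarrow> 0) (at_right 0)" "(E \<longlongrightarrow> 0) (at_right 0)" "(D \<longlongrightarrow> 0) (at_right 0)"
    unfolding R_def[abs_def] E_def[abs_def] D_def[abs_def]
    using \<beta> r by (auto intro: smalloD_tendsto)
  \<comment> \<open>\<open>Q\<close> is the difference quotient of \<open>\<beta>\<close> at 0, so
    \<open>\<beta> \<tau> = 1 + \<tau> * Q \<tau>\<close>; \<open>P\<close> is the cubic coefficient
    left over in \<open>\<tau> * (\<beta> \<tau>)\<^sup>2\<close>.\<close>
  define Q where "Q \<tau> = b1 + \<tau> * (b2 / 2 + R \<tau>)" for \<tau>
  define P where "P \<tau> = b2 + 2 * R \<tau> + (Q \<tau>)\<^sup>2" for \<tau>
  have Q: "(Q \<longlongrightarrow> b1) (at_right 0)"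
    unfolding Q_def[abs_def] by (auto intro!: tendsto_eq_intros lim)
  then have P: "(P \<longlongrightarrow> b2 + b1\<^sup>2) (at_right 0)"
    unfolding P_def[abs_def] by (auto intro!: tendsto_eq_intros lim)
  \<comment> \<open>What remains of \<open>\<delta> \<tau> + \<tau>\<^sup>2\<close> after its linear
    and quadratic terms, divided by \<open>\<tau>\<^sup>2\<close>.\<close>
  define A where "A \<tau> = E \<tau> + \<tau> * Q \<tau> * \<delta>1 + (1 + \<tau> * Q \<tau>) * (\<tau> * (\<delta>2 + D \<tau>))" for \<tau>
  have A: "(A \<longlongrightarrow> 0) (at_right 0)"
    unfolding A_def[abs_def] by (auto intro!: tendsto_eq_intros lim Q)
  let ?g = "grad F x"
  let ?res = "\<lambda>\<tau>. ((\<tau> * P \<tau>) *\<^sub>R v - A \<tau> *\<^sub>R ?g, R \<tau> *\<^sub>R v - D \<tau> *\<^sub>R ?g)"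
  have "((\<lambda>\<tau>. 1 + \<tau> * Q \<tau>) \<longlongrightarrow> 1) (at_right 0)"
    by (auto intro!: tendsto_eq_intros Q)
  then have pos: "\<forall>\<^sub>F \<tau> in at_right 0. 0 < 1 + \<tau> * Q \<tau>"
    by (rule order_tendstoD) simp
  have "\<forall>\<^sub>F \<tau> in at_right 0. nag_template F \<beta> \<delta> \<eta> X \<tau>
      - (X + \<tau> *\<^sub>R nag_\<Gamma>0 F b1 \<eta>1 \<delta>1 X + (\<tau>\<^sup>2 / 2) *\<^sub>R nag_\<Gamma>11 F b1 b2 \<eta>2 \<delta>1 \<delta>2 X) = \<tau>\<^sup>2 *\<^sub>R ?res \<tau>"
    using pos \<eta> \<delta> eventually_at_right_less[of 0]
  proof eventually_elim
    case (elim \<tau>)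
    then have \<tau>: "0 < \<tau>" by simp
    have \<beta>Q: "\<beta> \<tau> = 1 + \<tau> * Q \<tau>" and \<beta>R: "\<beta> \<tau> = 1 + \<tau> * b1 + \<tau>\<^sup>2 * (b2 / 2 + R \<tau>)"
      using \<tau> by (simp_all add: Q_def R_def field_simps power2_eq_square)
    have rr: "r\<^sub>\<eta> \<tau> = \<tau>\<^sup>2 * E \<tau>" "r\<^sub>\<delta> \<tau> = \<tau>\<^sup>2 * D \<tau>"
      using \<tau> by (simp_all add: E_def D_def)
    have \<beta>0: "\<beta> \<tau> \<noteq> 0" using elim \<beta>Q by simp
    have "\<eta> \<tau> / \<beta> \<tau> = \<tau> * \<eta>1 + \<tau>\<^sup>2 * \<eta>2 + r\<^sub>\<eta> \<tau>" using elim \<beta>0 by simp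
    moreover have "\<delta> \<tau> + \<tau>\<^sup>2 - \<eta> \<tau> / \<beta> \<tau> = (\<tau> * \<delta>1 + \<tau>\<^sup>2 * \<delta>2 + r\<^sub>\<delta> \<tau>) * (\<tau> * \<beta> \<tau>)"
      using elim(3) \<beta>0 \<tau> by (simp add: divide_eq_eq)
    \<comment> \<open>No expansion of \<open>\<delta>\<close> is assumed: it is recovered by
      clearing denominators in the two given ones. The factor \<open>\<tau> * \<beta> \<tau>\<close>
      turns \<open>\<delta>1\<close> into a quadratic coefficient, hence its place beside
      \<open>\<eta>2\<close>.\<close>
    ultimately have "\<delta> \<tau> + \<tau>\<^sup>2 = \<tau> * \<eta>1 + \<tau>\<^sup>2 * \<eta>2 + \<tau>\<^sup>2 * E \<tau> + (\<tau> * \<delta>1 + \<tau>\<^sup>2 * \<delta>2 + \<tau>\<^sup>2 * D \<tau>) * (\<tau> * (1 + \<tau> * Q \<tau>))"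
      unfolding rr \<beta>Q by linarith
    also have "\<dots> = \<tau> * \<eta>1 + \<tau>\<^sup>2 * (\<eta>2 + \<delta>1) + \<tau>\<^sup>2 * A \<tau>"
      unfolding A_def by algebra
    finally have c2: "\<delta> \<tau> + \<tau>\<^sup>2 = \<tau> * \<eta>1 + \<tau>\<^sup>2 * (\<eta>2 + \<delta>1) + \<tau>\<^sup>2 * A \<tau>" .
    have "\<tau> * (\<beta> \<tau>)\<^sup>2 = \<tau> + \<tau>\<^sup>2 * (2 * Q \<tau>) + \<tau> * (\<tau> * Q \<tau>)\<^sup>2"
      unfolding \<beta>Q by algebra
    also have "\<dots> = \<tau> + \<tau>\<^sup>2 * (2 * b1) + \<tau>\<^sup>2 * (\<tau> * P \<tau>)"
    proof -
      have "2 * Q \<tau> = 2 * b1 + \<tau> * (b2 + 2 * R \<tau>)" by (simp add: Q_def algebra_simps)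
      then show ?thesis unfolding P_def by algebra
    qed
    finally have c1: "\<tau> * (\<beta> \<tau>)\<^sup>2 = \<tau> + \<tau>\<^sup>2 * (2 * b1) + \<tau>\<^sup>2 * (\<tau> * P \<tau>)" .
    show ?case
      \<comment> \<open>The order matters: \<open>elim(3)\<close> must match before
        \<open>c2\<close> rewrites its numerator, and \<open>c1\<close> before
        \<open>\<beta>R\<close> expands the remaining \<open>\<beta> \<tau>\<close>.\<close>
      unfolding X nag_template_def nag_\<Gamma>0_def nag_\<Gamma>11_def prod.case
      unfolding elim(3) rr(2)
      unfolding c1 c2
      unfolding \<beta>R
      by (simp add: vec_eq_iff algebra_simps)
  qed
  note eq = this
  have "((\<lambda>\<tau>. norm (?res \<tau>)) \<longlongrightarrow> 0) (at_right 0)"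
    by (auto intro!: tendsto_eq_intros lim P A simp: zero_prod_def)
  moreover have "\<forall>\<^sub>F \<tau> in at_right 0. norm (?res \<tau>) = norm (nag_template F \<beta> \<delta> \<eta> X \<tau>
      - (X + \<tau> *\<^sub>R nag_\<Gamma>0 F b1 \<eta>1 \<delta>1 X + (\<tau>\<^sup>2 / 2) *\<^sub>R nag_\<Gamma>11 F b1 b2 \<eta>2 \<delta>1 \<delta>2 X)) / \<tau>\<^sup>2"
    using eq eventually_at_right_less[of 0]
  proof eventually_elim
    case (elim \<tau>)
    show ?case unfolding elim(1) norm_scaleR using elim(2) by simp
  qed
  ultimately show ?thesis
    using eventually_at_right_less[of "0::real"]
    by (intro smalloI_tendsto) (auto simp: tendsto_cong elim: eventually_mono)
qed

section \<open>The method as an iteration of its template\<close>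

text \<open>Here \<open>q\<close>, \<open>p\<close>, \<open>a\<close> stand for consecutive iterates
  and \<open>g'\<close>, \<open>g\<close> for the gradients at \<open>q\<close>, \<open>p\<close>.
  The first component is the recursion of the method once the velocity is written out; given it, the
  second is forced.\<close>

lemma nag_step_iff_template_step:
  fixes p q a g g' :: "real ^ 'n"
  assumes "\<tau> \<noteq> 0" "b \<noteq> 0"
  shows "a = p - \<tau>\<^sup>2 *\<^sub>R g + b *\<^sub>R (p - q) - (d *\<^sub>R g - e *\<^sub>R g') \<longleftrightarrow>
    (a, (1 / (\<tau> * b)) *\<^sub>R (a - p + (e / b) *\<^sub>R g)) =
    (p + (\<tau> * b\<^sup>2) *\<^sub>R ((1 / (\<tau> * b)) *\<^sub>R (p - q + (e / b) *\<^sub>R g')) - (d + \<tau>\<^sup>2) *\<^sub>R g,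
     b *\<^sub>R ((1 / (\<tau> * b)) *\<^sub>R (p - q + (e / b) *\<^sub>R g')) - ((d + \<tau>\<^sup>2 - e / b) / (\<tau> * b)) *\<^sub>R g)"
    (is "?M \<longleftrightarrow> (a, ?v) = (?x, ?w)")
proof -
  have x: "?x = p - \<tau>\<^sup>2 *\<^sub>R g + b *\<^sub>R (p - q) - (d *\<^sub>R g - e *\<^sub>R g')"
    using assms by (simp add: vec_eq_iff field_simps power2_eq_square)
  moreover have "?v = ?w" if "a = ?x"
    using assms unfolding that x by (simp add: vec_eq_iff field_simps power2_eq_square)
  ultimately show ?thesis by (metis prod.inject)
qed

lemma nag_method_iff_template:
  assumes "0 < s" "\<beta> (sqrt s) \<noteq> 0"
  shows "nag_method F \<beta> \<delta> \<eta> s x \<longleftrightarrow>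
    (\<forall>k\<ge>1. nag_state F \<beta> \<eta> s x (k + 1) = nag_template F \<beta> \<delta> \<eta> (nag_state F \<beta> \<eta> s x k) (sqrt s))"
proof -
  define \<tau> where "\<tau> = sqrt s"
  then have \<tau>: "sqrt s = \<tau>" "s = \<tau>\<^sup>2" "\<tau> \<noteq> 0" "\<beta> \<tau> \<noteq> 0" using assms by simp_all
  show ?thesis
    unfolding nag_method_def nag_state_def nag_template_def prod.case \<tau>(1)
    unfolding \<tau>(2) nag_step_iff_template_step[OF \<tau>(3,4)] add_diff_cancel_right' ..
qed

theorem theorem3p3:
  fixes F :: "real ^ 'n \<Rightarrow> real"
    and \<beta> \<delta> \<eta> r\<^sub>\<eta> r\<^sub>\<delta> :: "real \<Rightarrow> real"
    and \<eta>1 \<eta>2 \<delta>1 \<delta>2 :: real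
  assumes "twice_cont_differentiable F"
    and "smooth_near_0 \<beta>" and "smooth_near_0 \<eta>" and "smooth_near_0 \<delta>"
    and "((\<lambda>s. \<beta> (sqrt s)) \<longlongrightarrow> 1) (at_right 0)"
    and "((\<lambda>s. \<delta> (sqrt s)) \<longlongrightarrow> 0) (at_right 0)"
    and "((\<lambda>s. (\<delta> (sqrt s) - \<eta> (sqrt s) / \<beta> (sqrt s)) / (sqrt s * \<beta> (sqrt s))) \<longlongrightarrow> 0)
           (at_right 0)"
    and "r\<^sub>\<eta> \<in> o[at_right 0](\<lambda>\<tau>. \<tau>\<^sup>2)" and "r\<^sub>\<delta> \<in> o[at_right 0](\<lambda>\<tau>. \<tau>\<^sup>2)"
    and "\<forall>\<^sub>F \<tau> in at_right 0. \<eta> \<tau> = \<beta> \<tau> * (\<tau> * \<eta>1 + \<tau>\<^sup>2 * \<eta>2 + r\<^sub>\<eta> \<tau>)"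
    and "\<forall>\<^sub>F \<tau> in at_right 0. (\<delta> \<tau> + \<tau>\<^sup>2 - \<eta> \<tau> / \<beta> \<tau>) / (\<tau> * \<beta> \<tau>) = \<tau> * \<delta>1 + \<tau>\<^sup>2 * \<delta>2 + r\<^sub>\<delta> \<tau>"
  shows "(\<forall>s>0. \<beta> (sqrt s) \<noteq> 0 \<longrightarrow>
            (\<forall>x. nag_method F \<beta> \<delta> \<eta> s x \<longleftrightarrow>
              (\<forall>k\<ge>1. nag_state F \<beta> \<eta> s x (k + 1)
                        = nag_template F \<beta> \<delta> \<eta> (nag_state F \<beta> \<eta> s x k) (sqrt s)))) \<and>
         is_resolution_ode (nag_template F \<beta> \<delta> \<eta>)
           (nag_\<Gamma>0 F (rderiv \<beta> 0) \<eta>1 \<delta>1)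
           (\<lambda>X. (1 / 2) *\<^sub>R (nag_\<Gamma>11 F (rderiv \<beta> 0) (rderiv (rderiv \<beta>) 0) \<eta>2 \<delta>1 \<delta>2 X
                             - nag_\<Gamma>12 F (rderiv \<beta> 0) \<eta>1 \<delta>1 X))"
proof (intro conjI allI impI)
  show "nag_method F \<beta> \<delta> \<eta> s x \<longleftrightarrow> (\<forall>k\<ge>1. nag_state F \<beta> \<eta> s x (k + 1)
      = nag_template F \<beta> \<delta> \<eta> (nag_state F \<beta> \<eta> s x k) (sqrt s))"
    if "0 < s" "\<beta> (sqrt s) \<noteq> 0" for s x
    using that by (rule nag_method_iff_template)
  \<comment> \<open>The assumption concerns only the limit of \<open>\<beta>\<close>;
    differentiability at 0 turns it into the value \<open>\<beta> 0 = 1\<close>, the constant term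
    of the Taylor expansion.\<close>
  have "\<beta> differentiable (at 0 within {0..})"
    using assms(2) unfolding smooth_near_0_def by (metis atLeastLessThan_iff funpow_0 order_refl)
  then have "continuous (at 0 within {0..}) \<beta>"
    by (rule differentiable_imp_continuous_within)
  then have "(\<beta> \<longlongrightarrow> \<beta> 0) (at_right 0)"
    unfolding continuous_within by (rule tendsto_within_subset) auto
  then have "((\<lambda>s. \<beta> (sqrt s)) \<longlongrightarrow> \<beta> 0) (at_right 0)"
    using filterlim_sqrt_at_right_0 by (rule filterlim_compose)
  with assms(5) have "\<beta> 0 = 1"
    using tendsto_unique trivial_limit_at_right_real by blast
  with smooth_near_0_taylor2[OF assms(2)]
  have "(\<lambda>\<tau>. \<beta> \<tau> - (1 + \<tau> * rderiv \<beta> 0 + \<tau>\<^sup>2 / 2 * rderiv (rderiv \<beta>) 0)) \<in> o[at_right 0](\<lambda>\<tau>. \<tau>\<^sup>2)"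
    by simp
  note exp = nag_template_expansion[OF this assms(8-11), of F]
  show "is_resolution_ode (nag_template F \<beta> \<delta> \<eta>) (nag_\<Gamma>0 F (rderiv \<beta> 0) \<eta>1 \<delta>1)
      (\<lambda>X. (1 / 2) *\<^sub>R (nag_\<Gamma>11 F (rderiv \<beta> 0) (rderiv (rderiv \<beta>) 0) \<eta>2 \<delta>1 \<delta>2 X
                        - nag_\<Gamma>12 F (rderiv \<beta> 0) \<eta>1 \<delta>1 X))"
    \<comment> \<open>The \<open>nag_\<Gamma>12\<close> in the correction cancels against the
      derivative term of the flow, leaving half of \<open>nag_\<Gamma>11\<close> as in
      \<open>exp\<close>.\<close>
    by (rule is_resolution_ode_of_expansion[OF nag_\<Gamma>0_has_derivative[OF assms(1)] continuous_on_nag_\<Gamma>1[OF assms(1)]])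
      (use exp in \<open>simp add: nag_\<Gamma>12_eq scaleR_diff_right\<close>)
qed

end
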